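(* An isotropic extremal in $(\mathrm{GL}^+(2,\mathbb{C}),d)$ is nonstrictly abnormal if and only if it is a 1-parameter subgroup with an initial nonzero isotropic vector in $(H,\langle\cdot,\cdot\rangle)$ (i.e. $g(t)=\exp(tX)$ with $0\ne X\in H$, $\langle X,X\rangle=0$), or a left shift of such a 1-parameter subgroup.
   Context: $\mathrm{GL}^+(2,\mathbb{C})$ is the Lie group of complex $2\times2$ matrices with positive real determinant; $\mathfrak{g}=\mathfrak{gl}^+(2,\mathbb{C})$ is its Lie algebra (complex $2\times2$ matrices with real trace). Let $e_0=\frac12 I$, $e_1=\frac12\begin{pmatrix}0&1\\1&0\end{pmatrix}$, $e_2=\frac12\begin{pmatrix}0&\mathbf{i}\\-\mathbf{i}&0\end{pmatrix}$, $e_3=\frac12\begin{pmatrix}1&0\\0&-1\end{pmatrix}$. $H=\mathrm{span}_{\mathbb{R}}(e_0,\dots,e_3)$ is the space of Hermitian matrices, with pseudoscalar product $\langle\cdot,\cdot\rangle$ whose quadratic form is $\langle h,h\rangle=h_0^2-h_1^2-h_2^2-h_3^2=4\det h$ for $h=\sum h_ie_i$. $l_g:h\mapsto gh$ is the left shift. $d(x,y)$ is the supremum of lengths $\int\sqrt{\langle u,u\rangle}\,dt$ of Lipschitzian curves from $x$ to $y$ with $g'(t)=dl_{g(t)}(u(t))$, where for almost all $t$ $u(t)\in H$, $\langle u(t),u(t)\rangle\ge0$, $\langle u(t),e_0\rangle>0$ ($-\infty$ if there are none). A future directed isotropic horizontal curve is a locally Lipschitzian curve $g(t)$, $t\in\mathbb{R}$,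 with $g'(t)=dl_{g(t)}(u(t))$, $u(t)\in H$ measurable, $\langle u(t),u(t)\rangle=0$ and $\langle u(t),e_0\rangle>0$ for almost all $t$. Put $W=\{w\in H\mid\langle w,e_0\rangle=0,\ \langle w,w\rangle=-1\}$. Such a curve is a normal isotropic extremal if, after a proportional change of parameter $t\mapsto\lambda t$, $\lambda>0$, its control has the form $u(t)=e_0+w(t)$, $w(t)\in W$, and there is an absolutely continuous $\psi(t)\in\mathfrak{g}^*$ with $\psi(t)(e_0)\equiv1$ such that for almost all $t$: $\frac{d}{dt}\psi(t)(v)=\psi(t)([u(t),v])$ for all $v\in\mathfrak{g}$, and $\psi(t)(w(t))=\min_{w\in W}\psi(t)(w)=-1$. It is an abnormal isotropic extremal if there is an absolutely continuous nowhere vanishing $\psi(t)\in\mathfrak{g}^*$ with $\psi(t)|_H=0$ for all $t$ and $\frac{d}{dt}\psi(t)(v)=\psi(t)([u(t),v])$ for all $v\in\mathfrak{g}$ and almost all $t$. An isotropic extremal is a normal or abnormal one; it is nonstrictly abnormal if it is both normal and abnormal (with respect to different covector functions). *)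

theory Defs
  imports "HOL-Analysis.Analysis"
begin

type_synonym cmat = "complex^2^2"

section \<open>The group, its Lie algebra and the Hermitian subspace\<close>

definition GLp :: "cmat set" where
  "GLp = {A. det A \<in> \<real> \<and> Re (det A) > 0}"

definition glp :: "cmat set" where
  "glp = {A. trace A \<in> \<real>}"

definition commutator :: "cmat \<Rightarrow> cmat \<Rightarrow> cmat" where
  "commutator A B = A ** B - B ** A"

definition left_shift :: "cmat \<Rightarrow> cmat \<Rightarrow> cmat" where
  "left_shift g h = g ** h"

text \<open>The left shift is linear, hence it is its own differential; below,
  \<open>left_shift (g t) (u t)\<close> stands for the differential of the left shift applied to \<open>u t\<close>.\<close>

lemma left_shift_has_derivative:
  "(left_shift g has_derivative left_shift g) (at x)"
proof -
  have "linear (left_shift g)"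
    by (rule linearI)
      (auto simp: left_shift_def matrix_matrix_mult_def vec_eq_iff sum.distrib
        distrib_left scaleR_sum_right)
  then show ?thesis
    by (rule linear_imp_has_derivative)
qed

definition e0 :: cmat where "e0 = (1/2) *\<^sub>R mat 1"
definition e1 :: cmat where "e1 = (1/2) *\<^sub>R vector [vector [0, 1], vector [1, 0]]"
definition e2 :: cmat where "e2 = (1/2) *\<^sub>R vector [vector [0, \<i>], vector [- \<i>, 0]]"
definition e3 :: cmat where "e3 = (1/2) *\<^sub>R vector [vector [1, 0], vector [0, - 1]]"

text \<open>Here \<^const>\<open>span\<close> is the real linear span.\<close>

definition Herm :: "cmat set" where
  "Herm = span {e0, e1, e2, e3}"

text \<open>On \<^const>\<open>Herm\<close> the following functionals are the coordinates with respect to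
  \<open>e0, e1, e2, e3\<close>, see \<open>coord_combination\<close>. The product is only meant to be applied to
  elements of \<^const>\<open>Herm\<close>.\<close>

definition coord0 :: "cmat \<Rightarrow> real" where "coord0 h = Re (h $ 1 $ 1 + h $ 2 $ 2)"
definition coord1 :: "cmat \<Rightarrow> real" where "coord1 h = Re (h $ 1 $ 2 + h $ 2 $ 1)"
definition coord2 :: "cmat \<Rightarrow> real" where "coord2 h = Im (h $ 1 $ 2 - h $ 2 $ 1)"
definition coord3 :: "cmat \<Rightarrow> real" where "coord3 h = Re (h $ 1 $ 1 - h $ 2 $ 2)"

definition pseudo_prod :: "cmat \<Rightarrow> cmat \<Rightarrow> real" where
  "pseudo_prod x y =
     coord0 x * coord0 y - coord1 x * coord1 y - coord2 x * coord2 y - coord3 x * coord3 y"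

lemma coord_combination:
  fixes a b c d :: real
  defines "h \<equiv> a *\<^sub>R e0 + b *\<^sub>R e1 + c *\<^sub>R e2 + d *\<^sub>R e3"
  shows "coord0 h = a" "coord1 h = b" "coord2 h = c" "coord3 h = d"
  by (simp_all add: h_def coord0_def coord1_def coord2_def coord3_def
      e0_def e1_def e2_def e3_def mat_def field_simps)

lemma Herm_iff:
  "h \<in> Herm \<longleftrightarrow> (\<exists>a b c d. h = a *\<^sub>R e0 + b *\<^sub>R e1 + c *\<^sub>R e2 + d *\<^sub>R e3)"
  unfolding Herm_def span_insert
  by (simp add: algebra_simps)

lemma pseudo_prod_eq_det:
  assumes "h \<in> Herm"
  shows "complex_of_real (pseudo_prod h h) = 4 * det h"
proof -
  obtain a b c d where h: "h = a *\<^sub>R e0 + b *\<^sub>R e1 + c *\<^sub>R e2 + d *\<^sub>R e3"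
    using assms by (auto simp: Herm_iff)
  show ?thesis
    unfolding h pseudo_prod_def coord_combination
    by (simp add: det_2 e0_def e1_def e2_def e3_def mat_def complex_eq_iff algebra_simps)
qed

definition W :: "cmat set" where
  "W = {w \<in> Herm. pseudo_prod w e0 = 0 \<and> pseudo_prod w w = - 1}"

section \<open>Matrix exponential\<close>

text \<open>The componentwise ring operations on vectors make \<^const>\<open>exp\<close> and \<open>A ^ n\<close> unsuitable.\<close>

definition mexp :: "cmat \<Rightarrow> cmat" where
  "mexp A = (\<Sum>n. (1 / fact n) *\<^sub>R (((**) A) ^^ n) (mat 1))"

definition one_param_subgroup :: "cmat \<Rightarrow> real \<Rightarrow> cmat" where
  "one_param_subgroup X t = mexp (t *\<^sub>R X)"

section \<open>Horizontal curves and covector functions\<close>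

definition locally_lipschitz :: "(real \<Rightarrow> cmat) \<Rightarrow> bool" where
  "locally_lipschitz g \<longleftrightarrow> (\<forall>t. \<exists>\<epsilon>>0. \<exists>L. L-lipschitz_on (cball t \<epsilon>) g)"

definition control_of :: "(real \<Rightarrow> cmat) \<Rightarrow> (real \<Rightarrow> cmat) \<Rightarrow> bool" where
  "control_of g u \<longleftrightarrow>
     u \<in> borel_measurable lebesgue \<and>
     (AE t in lebesgue. u t \<in> Herm \<and>
        (g has_vector_derivative left_shift (g t) (u t)) (at t))"

definition isotropic_curve :: "(real \<Rightarrow> cmat) \<Rightarrow> bool" where
  "isotropic_curve g \<longleftrightarrow>
     range g \<subseteq> GLp \<and> locally_lipschitz g \<and>
     (\<exists>u. control_of g u \<and>
        (AE t in lebesgue. pseudo_prod (u t) (u t) = 0 \<and> pseudo_prod (u t) e0 > 0))"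

text \<open>A covector is a real linear functional on the subspace \<^const>\<open>glp\<close>; its values off
  \<^const>\<open>glp\<close> play no role.\<close>

definition covector :: "(cmat \<Rightarrow> real) \<Rightarrow> bool" where
  "covector f \<longleftrightarrow>
     (\<forall>x\<in>glp. \<forall>y\<in>glp. f (x + y) = f x + f y) \<and>
     (\<forall>c. \<forall>x\<in>glp. f (c *\<^sub>R x) = c * f x)"

definition abs_continuous_on_interval :: "real \<Rightarrow> real \<Rightarrow> (real \<Rightarrow> real) \<Rightarrow> bool" where
  "abs_continuous_on_interval a b f \<longleftrightarrow>
     (\<forall>\<epsilon>>0. \<exists>\<delta>>0. \<forall>n (l :: nat \<Rightarrow> real) r.
        (\<forall>i<n. a \<le> l i \<and> l i \<le> r i \<and> r i \<le> b) \<longrightarrow>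
        (\<forall>i<n. \<forall>j<n. i \<noteq> j \<longrightarrow> {l i<..<r i} \<inter> {l j<..<r j} = {}) \<longrightarrow>
        (\<Sum>i<n. r i - l i) < \<delta> \<longrightarrow>
        (\<Sum>i<n. \<bar>f (r i) - f (l i)\<bar>) < \<epsilon>)"

text \<open>On the whole line, absolute continuity is understood on every compact interval. For a function
  with values in the finite-dimensional dual of \<^const>\<open>glp\<close>, it is equivalent to absolute
  continuity of all evaluations.\<close>

definition abs_continuous_covector :: "(real \<Rightarrow> cmat \<Rightarrow> real) \<Rightarrow> bool" where
  "abs_continuous_covector \<psi> \<longleftrightarrow>
     (\<forall>t. covector (\<psi> t)) \<and>
     (\<forall>v\<in>glp. \<forall>a b. abs_continuous_on_interval a b (\<lambda>t. \<psi> t v))"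

definition adjoint_equation :: "(real \<Rightarrow> cmat) \<Rightarrow> (real \<Rightarrow> cmat \<Rightarrow> real) \<Rightarrow> bool" where
  "adjoint_equation u \<psi> \<longleftrightarrow>
     (AE t in lebesgue. \<forall>v\<in>glp.
        ((\<lambda>s. \<psi> s v) has_real_derivative \<psi> t (commutator (u t) v)) (at t))"

section \<open>Extremals\<close>

definition normal_isotropic_extremal :: "(real \<Rightarrow> cmat) \<Rightarrow> bool" where
  "normal_isotropic_extremal g \<longleftrightarrow>
     isotropic_curve g \<and>
     (\<exists>c>0. \<exists>w \<psi>.
        control_of (\<lambda>t. g (c * t)) (\<lambda>t. e0 + w t) \<and>
        (AE t in lebesgue. w t \<in> W) \<and>
        abs_continuous_covector \<psi> \<and>
        (\<forall>t. \<psi> t e0 = 1) \<and>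
        adjoint_equation (\<lambda>t. e0 + w t) \<psi> \<and>
        (AE t in lebesgue. is_arg_min (\<psi> t) (\<lambda>x. x \<in> W) (w t) \<and> \<psi> t (w t) = - 1))"

definition abnormal_isotropic_extremal :: "(real \<Rightarrow> cmat) \<Rightarrow> bool" where
  "abnormal_isotropic_extremal g \<longleftrightarrow>
     isotropic_curve g \<and>
     (\<exists>u \<psi>.
        control_of g u \<and>
        abs_continuous_covector \<psi> \<and>
        (\<forall>t. \<exists>v\<in>glp. \<psi> t v \<noteq> 0) \<and>
        (\<forall>t. \<forall>h\<in>Herm. \<psi> t h = 0) \<and>
        adjoint_equation u \<psi>)"

definition isotropic_extremal :: "(real \<Rightarrow> cmat) \<Rightarrow> bool" where
  "isotropic_extremal g \<longleftrightarrow> normal_isotropic_extremal g \<or> abnormal_isotropic_extremal g"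

text \<open>The two covector functions are automatically different: one is 1 and the other is 0 at
  \<^const>\<open>e0\<close>.\<close>

definition nonstrictly_abnormal :: "(real \<Rightarrow> cmat) \<Rightarrow> bool" where
  "nonstrictly_abnormal g \<longleftrightarrow> normal_isotropic_extremal g \<and> abnormal_isotropic_extremal g"

end

theory Submission
  imports Defs
begin

text \<open>
  Identify a traceless Hermitian matrix with its coordinate vector in \<open>\<real>\<^sup>3\<close>.  Since \<open>e0\<close> is central,
  only the traceless part \<open>w\<close> of a control \<open>u\<close> acts in the adjoint equation, and the commutator of two
  traceless Hermitian matrices is \<open>\<i>\<close> times a traceless Hermitian matrix, given by the cross product
  (\<open>commutator_pauli\<close>).  The two kinds of covectors constrain \<open>w\<close> in complementary ways.

  \<^item> A normal covector is, on traceless Hermitian matrices, a linear functional of norm 1 that takes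
    its minimum on the unit sphere \<open>W\<close> at \<open>w\<close>; so it is minus the inner product with \<open>w\<close>
    (\<open>minimiser_on_W\<close>).
  \<^item> An abnormal covector vanishes on \<open>Herm\<close>, so it is given by a vector \<open>q\<close>, through its values on
    \<open>\<i>\<close> times traceless Hermitian matrices.  The adjoint equation on those matrices shows that \<open>q\<close> is
    constant, and on \<open>Herm\<close> it says that \<open>w\<close> is parallel to \<open>q\<close> (\<open>abnormal_covector_constant\<close>,
    \<open>abnormal_direction\<close>).

  If both exist, \<open>w\<close> commutes with the fixed matrix of \<open>q\<close>, so the normal covector has a
  constant value at that matrix.  This value is minus the inner product of \<open>w\<close> and \<open>q\<close>, and a vector
  parallel to \<open>q\<close> is determined by it.  Hence \<open>w\<close>, and with it the control \<open>P = e0 + w\<close>, is constant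
  almost everywhere.  The matrix \<open>P\<close> is idempotent, so its exponential is elementary, and the
  locally Lipschitz solution of \<open>g' = g P\<close> is unique (\<open>flow_unique\<close>).

  Conversely, along \<open>a exp(tX)\<close> with \<open>X = \<tau> (e0 + w)\<close> two covectors that do not depend on time serve:
  the functionals \<open>v \<mapsto> 2 Re tr (v (e0 - w))\<close> and \<open>v \<mapsto> Im tr (v w)\<close>.  They satisfy the adjoint equation
  because both \<open>e0 - w\<close> and \<open>w\<close> commute with \<open>X\<close>.  Here \<open>\<tau>\<close> is positive because the curve, being an
  extremal, is future directed.

  Each passage from an equation for a derivative, valid almost everywhere, to a constant rests on one
  fact of real analysis: an absolutely continuous function whose derivative is 0 almost everywhere is
  constant (\<open>zero_AE_derivative_constant\<close>).
\<close>

section \<open>Curves whose derivative vanishes almost everywhere\<close>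

text \<open>Absolute continuity in a form that applies directly to the intervals of a tagged division, which
  are not numbered.\<close>

lemma abs_continuous_finite_family:
  assumes ac: "abs_continuous_on_interval a b f" and "\<epsilon> > 0"
  shows "\<exists>\<delta>>0. \<forall>I (l :: 'i \<Rightarrow> real) r. finite I \<longrightarrow> (\<forall>i\<in>I. a \<le> l i \<and> l i \<le> r i \<and> r i \<le> b) \<longrightarrow>
      (\<forall>i\<in>I. \<forall>j\<in>I. i \<noteq> j \<longrightarrow> {l i<..<r i} \<inter> {l j<..<r j} = {}) \<longrightarrow>
      (\<Sum>i\<in>I. r i - l i) < \<delta> \<longrightarrow> (\<Sum>i\<in>I. \<bar>f (r i) - f (l i)\<bar>) < \<epsilon>"
  using ac[unfolded abs_continuous_on_interval_def, rule_format, OF \<open>\<epsilon> > 0\<close>]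
proof (elim exE conjE, intro exI conjI allI impI)
  fix \<delta> I and l r :: "'i \<Rightarrow> real"
  assume \<delta>: "\<forall>n (l :: nat \<Rightarrow> real) r. (\<forall>i<n. a \<le> l i \<and> l i \<le> r i \<and> r i \<le> b) \<longrightarrow>
        (\<forall>i<n. \<forall>j<n. i \<noteq> j \<longrightarrow> {l i<..<r i} \<inter> {l j<..<r j} = {}) \<longrightarrow>
        (\<Sum>i<n. r i - l i) < \<delta> \<longrightarrow> (\<Sum>i<n. \<bar>f (r i) - f (l i)\<bar>) < \<epsilon>"
    and "finite I" and bounds: "\<forall>i\<in>I. a \<le> l i \<and> l i \<le> r i \<and> r i \<le> b"
    and disj: "\<forall>i\<in>I. \<forall>j\<in>I. i \<noteq> j \<longrightarrow> {l i<..<r i} \<inter> {l j<..<r j} = {}"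
    and len: "(\<Sum>i\<in>I. r i - l i) < \<delta>"
  obtain h where h: "bij_betw h {..<card I} I"
    using ex_bij_betw_nat_finite[OF \<open>finite I\<close>] by (auto simp: atLeast0LessThan)
  have mem: "h i \<in> I" if "i < card I" for i
    using h that by (auto simp: bij_betw_def)
  have inj: "h i \<noteq> h j" if "i < card I" "j < card I" "i \<noteq> j" for i j
    using h that by (auto simp: bij_betw_def inj_on_def)
  have "(\<Sum>i<card I. r (h i) - l (h i)) < \<delta>"
    using sum.reindex_bij_betw[OF h, of "\<lambda>i. r i - l i"] len by simp
  then have "(\<Sum>i<card I. \<bar>f (r (h i)) - f (l (h i))\<bar>) < \<epsilon>"
    using \<delta>[rule_format, of "card I" "l \<circ> h" "r \<circ> h"] bounds disj mem inj by simp
  then show "(\<Sum>i\<in>I. \<bar>f (r i) - f (l i)\<bar>) < \<epsilon>"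
    using sum.reindex_bij_betw[OF h, of "\<lambda>i. \<bar>f (r i) - f (l i)\<bar>"] by simp
qed

text \<open>The gauge controls the increments of \<open>f\<close> over intervals tagged by points of \<open>S\<close>.\<close>

lemma zero_derivative_gauge:
  fixes f :: "real \<Rightarrow> real"
  assumes "\<And>x. x \<in> S \<Longrightarrow> (f has_real_derivative 0) (at x)" and "\<epsilon> > 0"
  obtains \<gamma> where "gauge \<gamma>"
    and "\<And>x y. x \<in> S \<Longrightarrow> y \<in> \<gamma> x \<Longrightarrow> \<bar>f y - f x\<bar> \<le> \<epsilon> * \<bar>y - x\<bar>"
proof -
  have "\<exists>d>0. x \<in> S \<longrightarrow> (\<forall>y. \<bar>y - x\<bar> < d \<longrightarrow> \<bar>f y - f x\<bar> \<le> \<epsilon> * \<bar>y - x\<bar>)" for x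
  proof (cases "x \<in> S")
    case True
    then have "(f has_derivative (\<lambda>_. 0)) (at x)"
      using assms(1)[OF True] unfolding has_field_derivative_def lambda_zero by simp
    then show ?thesis
      using \<open>\<epsilon> > 0\<close> unfolding has_derivative_at_alt by fastforce
  qed (auto intro: zero_less_one)
  then obtain d where d: "\<And>x. d x > 0"
    "\<And>x y. x \<in> S \<Longrightarrow> \<bar>y - x\<bar> < d x \<Longrightarrow> \<bar>f y - f x\<bar> \<le> \<epsilon> * \<bar>y - x\<bar>"
    by metis
  show thesis
  proof
    show "gauge (\<lambda>x. ball x (d x))"
      using d(1) by (intro gaugeI) auto
  qed (use d(2) in \<open>auto simp: dist_real_def abs_minus_commute\<close>)
qed

text \<open>A fine tagged division splits the increment of \<open>f\<close> into two parts.  Intervals tagged by a point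
  with zero derivative contribute at most \<open>\<epsilon>\<close> times their length.  The other tags lie in a null set
  \<open>N\<close>; since the gauge integral of the indicator of \<open>N\<close> is 0, a fine enough division gives their
  intervals total length below the \<open>\<delta>\<close> of absolute continuity, so they contribute less than \<open>\<epsilon>\<close>.\<close>

lemma abs_continuous_zero_derivative_constant:
  fixes f :: "real \<Rightarrow> real"
  assumes ac: "abs_continuous_on_interval a b f" and "a \<le> b"
    and deriv: "AE t in lebesgue. t \<in> {a..b} \<longrightarrow> (f has_real_derivative 0) (at t)"
  shows "f a = f b"
proof -
  define N where "N = {t. \<not> (t \<in> {a..b} \<longrightarrow> (f has_real_derivative 0) (at t))}"
  have N: "negligible N"
    using deriv by (simp add: N_def negligible_iff_null_sets completion.AE_iff_null_sets)
  have "\<bar>f b - f a\<bar> \<le> \<epsilon> * (b - a + 1)" if "\<epsilon> > 0" for \<epsilon>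
  proof -
    obtain \<delta> where "\<delta> > 0" and \<delta>: "\<forall>I (l :: real \<times> real set \<Rightarrow> real) r. finite I \<longrightarrow>
        (\<forall>i\<in>I. a \<le> l i \<and> l i \<le> r i \<and> r i \<le> b) \<longrightarrow>
        (\<forall>i\<in>I. \<forall>j\<in>I. i \<noteq> j \<longrightarrow> {l i<..<r i} \<inter> {l j<..<r j} = {}) \<longrightarrow>
        (\<Sum>i\<in>I. r i - l i) < \<delta> \<longrightarrow> (\<Sum>i\<in>I. \<bar>f (r i) - f (l i)\<bar>) < \<epsilon>"
      using abs_continuous_finite_family[OF ac \<open>\<epsilon> > 0\<close>] by (elim exE conjE)
    have "(indicat_real N has_integral 0) (cbox a b)"
      using N unfolding negligible_def by blast
    then obtain \<gamma>1 where \<gamma>1: "gauge \<gamma>1"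
      "\<And>p. p tagged_division_of {a..b} \<Longrightarrow> \<gamma>1 fine p \<Longrightarrow>
        \<bar>\<Sum>(x,K)\<in>p. measure lborel K * indicat_real N x\<bar> < \<delta>"
      using \<open>\<delta> > 0\<close> unfolding has_integral by (auto simp: split_beta')
    obtain \<gamma>2 where \<gamma>2: "gauge \<gamma>2"
      "\<And>x y. x \<in> {a..b} - N \<Longrightarrow> y \<in> \<gamma>2 x \<Longrightarrow> \<bar>f y - f x\<bar> \<le> \<epsilon> * \<bar>y - x\<bar>"
      using zero_derivative_gauge[of "{a..b} - N" f \<epsilon>] \<open>\<epsilon> > 0\<close> unfolding N_def by blast
    obtain p where p: "p tagged_division_of {a..b}" and "(\<lambda>x. \<gamma>1 x \<inter> \<gamma>2 x) fine p"
      using fine_division_exists_real[OF gauge_Int[OF \<gamma>1(1) \<gamma>2(1)]] .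
    then have fine: "\<gamma>1 fine p" "\<gamma>2 fine p"
      by (auto simp: fine_def)
    note pD = tagged_division_ofD[OF p]
    have K: "K = {Inf K..Sup K} \<and> Inf K \<le> x \<and> x \<le> Sup K \<and> a \<le> Inf K \<and> Sup K \<le> b
        \<and> measure lborel K = Sup K - Inf K" if xK: "(x, K) \<in> p" for x K
    proof -
      obtain c d where "K = {c..d}"
        using pD(4)[OF xK] by auto
      then show ?thesis
        using pD(2,3)[OF xK] by auto
    qed
    \<comment> \<open>On a division fine for \<open>\<gamma>1\<close> the Riemann sum of the indicator of \<open>N\<close> is the total length of the
      intervals tagged in \<open>N\<close>.\<close>
    define bad where "bad = {(x, K) \<in> p. x \<in> N}"
    have "bad \<subseteq> p"
      by (auto simp: bad_def)
    then have "finite bad"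
      using pD(1) finite_subset by blast
    have "(\<Sum>(x,K)\<in>p. measure lborel K * indicat_real N x) = (\<Sum>(x,K)\<in>bad. Sup K - Inf K)"
      using K by (intro sum.mono_neutral_cong_right[OF pD(1) \<open>bad \<subseteq> p\<close>])
        (auto simp: bad_def indicator_def)
    then have bad_len: "(\<Sum>i\<in>bad. Sup (snd i) - Inf (snd i)) < \<delta>"
      using \<gamma>1(2)[OF p fine(1)] by (simp add: split_beta')
    have bad_sum: "(\<Sum>i\<in>bad. \<bar>f (Sup (snd i)) - f (Inf (snd i))\<bar>) < \<epsilon>"
    proof (rule \<delta>[rule_format, OF \<open>finite bad\<close> _ _ bad_len])
      show "a \<le> Inf (snd i) \<and> Inf (snd i) \<le> Sup (snd i) \<and> Sup (snd i) \<le> b"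
        if "i \<in> bad" for i
        using K[of "fst i" "snd i"] that \<open>bad \<subseteq> p\<close> by auto
      show "{Inf (snd i)<..<Sup (snd i)} \<inter> {Inf (snd j)<..<Sup (snd j)} = {}"
        if "i \<in> bad" "j \<in> bad" "i \<noteq> j" for i j
      proof -
        have ij: "(fst i, snd i) \<in> p" "(fst j, snd j) \<in> p"
          using that \<open>bad \<subseteq> p\<close> by auto
        then have "interior (snd i) \<inter> interior (snd j) = {}"
          using pD(5) that(3) by (metis prod.collapse)
        moreover have "interior (snd i) = {Inf (snd i)<..<Sup (snd i)}"
          "interior (snd j) = {Inf (snd j)<..<Sup (snd j)}"
          using K[OF ij(1)] K[OF ij(2)] interior_atLeastAtMost_real by metis+
        ultimately show ?thesis by simp
      qed
    qed
    have good: "\<bar>f (Sup K) - f (Inf K)\<bar> \<le> \<epsilon> * (Sup K - Inf K)"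
      if "(x, K) \<in> p - bad" for x K
    proof -
      have xK: "(x, K) \<in> p" "x \<notin> N"
        using that by (auto simp: bad_def)
      note K = K[OF xK(1)]
      have "x \<in> {a..b} - N" "Sup K \<in> \<gamma>2 x" "Inf K \<in> \<gamma>2 x"
        using K fine(2) xK unfolding fine_def by fastforce+
      then have "\<bar>f (Sup K) - f x\<bar> \<le> \<epsilon> * (Sup K - x)" "\<bar>f (Inf K) - f x\<bar> \<le> \<epsilon> * (x - Inf K)"
        using \<gamma>2(2)[of x] K by fastforce+
      then show ?thesis
        by (simp add: algebra_simps)
    qed
    have "f b - f a = (\<Sum>(x,K)\<in>p. f (Sup K) - f (Inf K))"
      using additive_tagged_division_1[OF \<open>a \<le> b\<close> p, of f] by simp
    then have "\<bar>f b - f a\<bar> \<le> (\<Sum>(x,K)\<in>p. \<bar>f (Sup K) - f (Inf K)\<bar>)"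
      by (simp add: split_beta' sum_abs)
    also have "\<dots> = (\<Sum>(x,K)\<in>p - bad. \<bar>f (Sup K) - f (Inf K)\<bar>)
        + (\<Sum>(x,K)\<in>bad. \<bar>f (Sup K) - f (Inf K)\<bar>)"
      using sum.subset_diff[OF \<open>bad \<subseteq> p\<close> pD(1)] .
    also have "\<dots> \<le> (\<Sum>(x,K)\<in>p - bad. \<epsilon> * (Sup K - Inf K)) + \<epsilon>"
      using good bad_sum by (intro add_mono sum_mono) (auto simp: split_beta')
    also have "(\<Sum>(x,K)\<in>p - bad. \<epsilon> * (Sup K - Inf K)) \<le> (\<Sum>(x,K)\<in>p. \<epsilon> * (Sup K - Inf K))"
      using K \<open>\<epsilon> > 0\<close> by (intro sum_mono2[OF pD(1)]) force+
    also have "(\<Sum>(x,K)\<in>p. \<epsilon> * (Sup K - Inf K)) = \<epsilon> * (b - a)"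
      using additive_tagged_division_1[OF \<open>a \<le> b\<close> p, of "\<lambda>x. \<epsilon> * x"]
      by (simp add: algebra_simps)
    finally show ?thesis
      by (simp add: algebra_simps)
  qed
  then have "\<bar>f b - f a\<bar> \<le> 0 + \<epsilon>" if "\<epsilon> > 0" for \<epsilon>
    using that \<open>a \<le> b\<close> by (metis add_0 add_nonneg_pos diff_ge_0_iff_ge divide_pos_pos
        nonzero_eq_divide_eq order_less_irrefl zero_less_one)
  then show ?thesis
    using field_le_epsilon[of "\<bar>f b - f a\<bar>" 0] by simp
qed

lemma zero_AE_derivative_constant:
  fixes f :: "real \<Rightarrow> real"
  assumes "\<And>a b. abs_continuous_on_interval a b f"
    and "AE t in lebesgue. (f has_real_derivative 0) (at t)"
  shows "f s = f t"
proof -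
  have "f a = f b" if "a \<le> b" for a b
    by (rule abs_continuous_zero_derivative_constant[OF assms(1) that])
      (use assms(2) in \<open>auto elim: eventually_mono\<close>)
  then show ?thesis
    by (metis linear)
qed

lemma lipschitz_imp_abs_continuous:
  fixes f :: "real \<Rightarrow> real"
  assumes "L-lipschitz_on {a..b} f"
  shows "abs_continuous_on_interval a b f"
  unfolding abs_continuous_on_interval_def
proof (intro allI impI)
  fix \<epsilon> :: real
  assume "\<epsilon> > 0"
  have "L \<ge> 0"
    using assms by (rule lipschitz_on_nonneg)
  show "\<exists>\<delta>>0. \<forall>n (l :: nat \<Rightarrow> real) r. (\<forall>i<n. a \<le> l i \<and> l i \<le> r i \<and> r i \<le> b) \<longrightarrow>
      (\<forall>i<n. \<forall>j<n. i \<noteq> j \<longrightarrow> {l i<..<r i} \<inter> {l j<..<r j} = {}) \<longrightarrow>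
      (\<Sum>i<n. r i - l i) < \<delta> \<longrightarrow> (\<Sum>i<n. \<bar>f (r i) - f (l i)\<bar>) < \<epsilon>"
  proof (intro exI[of _ "\<epsilon> / (L + 1)"] conjI allI impI)
    show "\<epsilon> / (L + 1) > 0"
      using \<open>\<epsilon> > 0\<close> \<open>L \<ge> 0\<close> by simp
    fix n :: nat and l r :: "nat \<Rightarrow> real"
    assume lr: "\<forall>i<n. a \<le> l i \<and> l i \<le> r i \<and> r i \<le> b" and len: "(\<Sum>i<n. r i - l i) < \<epsilon> / (L + 1)"
    have "(\<Sum>i<n. \<bar>f (r i) - f (l i)\<bar>) \<le> (\<Sum>i<n. (L + 1) * (r i - l i))"
    proof (rule sum_mono)
      fix i assume "i \<in> {..<n}"
      then have i: "a \<le> l i" "l i \<le> r i" "r i \<le> b"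
        using lr by auto
      then have "\<bar>f (r i) - f (l i)\<bar> \<le> L * (r i - l i)"
        using lipschitz_onD[OF assms, of "r i" "l i"] by (simp add: dist_real_def)
      then show "\<bar>f (r i) - f (l i)\<bar> \<le> (L + 1) * (r i - l i)"
        using i by (simp add: algebra_simps)
    qed
    also have "\<dots> = (L + 1) * (\<Sum>i<n. r i - l i)"
      by (simp add: sum_distrib_left)
    also have "\<dots> < \<epsilon>"
      using len \<open>L \<ge> 0\<close> by (simp add: field_simps)
    finally show "(\<Sum>i<n. \<bar>f (r i) - f (l i)\<bar>) < \<epsilon>" .
  qed
qed

lemma bounded_bilinear_matrix_mult:
  "bounded_bilinear ((**) :: cmat \<Rightarrow> cmat \<Rightarrow> cmat)"
  unfolding bilinear_conv_bounded_bilinear[symmetric] bilinear_def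
  by (intro conjI allI linearI)
    (simp_all add: matrix_add_ldistrib matrix_scalar_ac scalar_matrix_assoc[symmetric],
      simp add: matrix_matrix_mult_def vec_eq_iff distrib_right sum.distrib)

lemma matrix_mult_distribs:
  fixes A B C :: cmat
  shows "A ** (B + C) = A ** B + A ** C" "(A + B) ** C = A ** C + B ** C"
    "A ** (B - C) = A ** B - A ** C" "(A - B) ** C = A ** C - B ** C"
    "A ** (r *\<^sub>R B) = r *\<^sub>R (A ** B)" "(r *\<^sub>R A) ** B = r *\<^sub>R (A ** B)"
    "A ** (0::cmat) = 0" "(0::cmat) ** A = 0" "A ** (- B) = - (A ** B)" "(- A) ** B = - (A ** B)"
proof -
  interpret M: bounded_bilinear "(**) :: cmat \<Rightarrow> cmat \<Rightarrow> cmat"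
    by (rule bounded_bilinear_matrix_mult)
  show "A ** (B + C) = A ** B + A ** C" "(A + B) ** C = A ** C + B ** C"
    "A ** (B - C) = A ** B - A ** C" "(A - B) ** C = A ** C - B ** C"
    "A ** (r *\<^sub>R B) = r *\<^sub>R (A ** B)" "(r *\<^sub>R A) ** B = r *\<^sub>R (A ** B)"
    "A ** (0::cmat) = 0" "(0::cmat) ** A = 0" "A ** (- B) = - (A ** B)" "(- A) ** B = - (A ** B)"
    by (rule M.add_right M.add_left M.diff_right M.diff_left M.scaleR_right M.scaleR_left
        M.zero_right M.zero_left M.minus_right M.minus_left)+
qed

lemma locally_lipschitz_matrix_mult:
  assumes "locally_lipschitz F" "locally_lipschitz G"
  shows "locally_lipschitz (\<lambda>t. F t ** G t)"
  unfolding locally_lipschitz_def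
proof
  fix t
  interpret M: bounded_bilinear "(**) :: cmat \<Rightarrow> cmat \<Rightarrow> cmat"
    by (rule bounded_bilinear_matrix_mult)
  obtain \<epsilon>1 L where L: "\<epsilon>1 > 0" "L-lipschitz_on (cball t \<epsilon>1) F"
    using assms(1) unfolding locally_lipschitz_def by blast
  obtain \<epsilon>2 M where M: "\<epsilon>2 > 0" "M-lipschitz_on (cball t \<epsilon>2) G"
    using assms(2) unfolding locally_lipschitz_def by blast
  define S where "S = cball t (min \<epsilon>1 \<epsilon>2)"
  have F: "L-lipschitz_on S F" and G: "M-lipschitz_on S G"
    using L M by (auto simp: S_def intro: lipschitz_on_subset)
  have "compact S"
    by (simp add: S_def)
  have bdd: "bounded (H ` S)" if "C-lipschitz_on S H" for C and H :: "real \<Rightarrow> cmat"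
    using compact_continuous_image[OF lipschitz_on_continuous_on[OF that] \<open>compact S\<close>]
    by (rule compact_imp_bounded)
  obtain A where A: "A > 0" "\<And>s. s \<in> S \<Longrightarrow> norm (F s) \<le> A"
    using bdd[OF F] unfolding bounded_pos by blast
  obtain B where B: "B > 0" "\<And>s. s \<in> S \<Longrightarrow> norm (G s) \<le> B"
    using bdd[OF G] unfolding bounded_pos by blast
  obtain K where K: "K > 0" "\<And>(x::cmat) (y::cmat). norm (x ** y) \<le> norm x * norm y * K"
    using M.pos_bounded by blast
  have nn: "L \<ge> 0" "M \<ge> 0"
    using lipschitz_on_nonneg[OF F] lipschitz_on_nonneg[OF G] .
  have "(A * M * K + L * B * K)-lipschitz_on S (\<lambda>t. F t ** G t)"
  proof (rule lipschitz_onI)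
    fix x y
    assume xy: "x \<in> S" "y \<in> S"
    have "norm (F x) * norm (G x - G y) \<le> A * (M * dist x y)"
      using lipschitz_onD[OF G xy] A(2)[OF xy(1)] nn A(1)
      by (intro mult_mono) (simp_all add: dist_norm)
    then have "norm (F x ** (G x - G y)) \<le> A * (M * dist x y) * K"
      by (rule order_trans[OF K(2) mult_right_mono[OF _ less_imp_le[OF K(1)]]])
    moreover have "norm (F x - F y) * norm (G y) \<le> (L * dist x y) * B"
      using lipschitz_onD[OF F xy] B(2)[OF xy(2)] nn B(1)
      by (intro mult_mono) (simp_all add: dist_norm)
    then have "norm ((F x - F y) ** G y) \<le> (L * dist x y) * B * K"
      by (rule order_trans[OF K(2) mult_right_mono[OF _ less_imp_le[OF K(1)]]])
    moreover have "F x ** G x - F y ** G y = F x ** (G x - G y) + (F x - F y) ** G y"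
      by (simp add: M.diff_left M.diff_right)
    ultimately have "norm (F x ** G x - F y ** G y) \<le> A * (M * dist x y) * K + (L * dist x y) * B * K"
      by (simp add: norm_triangle_mono)
    then show "dist (F x ** G x) (F y ** G y) \<le> (A * M * K + L * B * K) * dist x y"
      by (simp add: dist_norm[of "F x ** G x"] algebra_simps)
  qed (use A B K nn in simp)
  then show "\<exists>\<epsilon>>0. \<exists>L. L-lipschitz_on (cball t \<epsilon>) (\<lambda>t. F t ** G t)"
    using L M unfolding S_def by (metis min_less_iff_conj)
qed

text \<open>The real components are Lipschitz, hence absolutely continuous, near each point, so the curve is
  locally constant; then its derivative is 0 everywhere.\<close>

lemma locally_lipschitz_zero_derivative_constant:
  fixes F :: "real \<Rightarrow> cmat"
  assumes lip: "locally_lipschitz F"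
    and deriv: "AE t in lebesgue. (F has_vector_derivative 0) (at t)"
  shows "F s = F t"
proof -
  have const: "F x = F y" if lip: "L-lipschitz_on {x..y} F" and "x \<le> y" for L x y
  proof (rule euclidean_eqI)
    fix b :: cmat
    assume "b \<in> Basis"
    have "L-lipschitz_on {x..y} (\<lambda>t. F t \<bullet> b)"
    proof (rule lipschitz_onI)
      fix u v assume "u \<in> {x..y}" "v \<in> {x..y}"
      then have "norm (F u - F v) \<le> L * dist u v"
        using lipschitz_onD[OF lip] by (simp add: dist_norm)
      then show "dist (F u \<bullet> b) (F v \<bullet> b) \<le> L * dist u v"
        using Basis_le_norm[OF \<open>b \<in> Basis\<close>, of "F u - F v"]
        by (simp add: dist_real_def inner_diff_left)
    qed (use lip lipschitz_on_nonneg in blast)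
    moreover have "AE t in lebesgue. t \<in> {x..y} \<longrightarrow> ((\<lambda>t. F t \<bullet> b) has_real_derivative 0) (at t)"
      using deriv
    proof eventually_elim
      case (elim t)
      have "((\<lambda>t. F t \<bullet> b) has_vector_derivative (0 \<bullet> b)) (at t)"
        by (rule bounded_linear.has_vector_derivative[OF bounded_linear_inner_left elim])
      then show ?case
        by (simp add: has_real_derivative_iff_has_vector_derivative)
    qed
    ultimately show "F x \<bullet> b = F y \<bullet> b"
      using abs_continuous_zero_derivative_constant[OF lipschitz_imp_abs_continuous \<open>x \<le> y\<close>] by blast
  qed
  have "(F has_derivative (\<lambda>h. 0)) (at x)" for x
  proof -
    obtain \<epsilon> L where "\<epsilon> > 0" and L: "L-lipschitz_on (cball x \<epsilon>) F"
      using lip unfolding locally_lipschitz_def by meson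
    have const_ball: "F x = F y" if "y \<in> ball x \<epsilon>" for y
    proof (cases "x \<le> y")
      case True
      then show ?thesis
        using const[of L x y] lipschitz_on_subset[OF L, of "{x..y}"] that
        by (auto simp: dist_real_def subset_iff)
    next
      case False
      then show ?thesis
        using const[of L y x] lipschitz_on_subset[OF L, of "{y..x}"] that
        by (auto simp: dist_real_def subset_iff)
    qed
    show ?thesis
      by (rule has_derivative_transform_within_open[OF has_derivative_const open_ball _ const_ball])
        (simp_all add: \<open>\<epsilon> > 0\<close>)
  qed
  then show ?thesis
    by (intro has_derivative_zero_unique[OF convex_UNIV]) simp_all
qed

lemma AE_lebesgue_imp_ex:
  fixes Q :: "real \<Rightarrow> bool"
  assumes "AE t in lebesgue. Q t"
  shows "\<exists>t. Q t"
proof (rule ccontr)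
  assume "\<nexists>t. Q t"
  then have "negligible (UNIV :: real set)"
    using assms by (simp add: negligible_iff_null_sets completion.AE_iff_null_sets)
  then show False
    using open_not_negligible[of "UNIV :: real set"] by simp
qed

lemma AE_lebesgue_rescale:
  fixes c :: real
  assumes "AE t in lebesgue. Q t" and "c \<noteq> 0"
  shows "AE t in lebesgue. Q (c * t)"
proof -
  have "negligible {t. \<not> Q t}"
    using assms(1) by (simp add: negligible_iff_null_sets completion.AE_iff_null_sets)
  then have "negligible ((\<lambda>t. t / c) ` {t. \<not> Q t})"
    by (intro negligible_differentiable_image_negligible)
      (auto intro!: derivative_intros simp: differentiable_on_def assms)
  also have "(\<lambda>t. t / c) ` {t. \<not> Q t} = {t. \<not> Q (c * t)}"
    using assms(2) by (auto simp: image_iff intro!: exI[of _ "c * _"])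
  finally show ?thesis
    by (simp add: negligible_iff_null_sets completion.AE_iff_null_sets)
qed

lemma locally_lipschitz_rescale:
  assumes "locally_lipschitz g" "c \<noteq> 0"
  shows "locally_lipschitz (\<lambda>t. g (c * t))"
  unfolding locally_lipschitz_def
proof
  fix t
  obtain \<epsilon> L where \<epsilon>: "\<epsilon> > 0" and L: "L-lipschitz_on (cball (c * t) \<epsilon>) g"
    using assms(1) unfolding locally_lipschitz_def by blast
  have "(L * \<bar>c\<bar>)-lipschitz_on (cball t (\<epsilon> / \<bar>c\<bar>)) (\<lambda>t. g (c * t))"
  proof (rule lipschitz_onI)
    have scale: "dist (c * x) (c * y) = \<bar>c\<bar> * dist x y" for x y
      unfolding dist_real_def by (simp add: right_diff_distrib[symmetric] abs_mult)
    fix x y assume "x \<in> cball t (\<epsilon> / \<bar>c\<bar>)" "y \<in> cball t (\<epsilon> / \<bar>c\<bar>)"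
    then have "c * x \<in> cball (c * t) \<epsilon>" "c * y \<in> cball (c * t) \<epsilon>"
      using assms(2) by (simp_all add: scale pos_le_divide_eq mult.commute)
    then show "dist (g (c * x)) (g (c * y)) \<le> L * \<bar>c\<bar> * dist x y"
      using lipschitz_onD[OF L, of "c * x" "c * y"] by (simp add: scale mult.assoc)
  qed (use lipschitz_on_nonneg[OF L] in simp)
  then show "\<exists>\<epsilon>>0. \<exists>L. L-lipschitz_on (cball t \<epsilon>) (\<lambda>t. g (c * t))"
    using \<epsilon> assms(2) by (intro exI[of _ "\<epsilon> / \<bar>c\<bar>"] conjI exI) auto
qed

lemma has_vector_derivative_rescale:
  fixes f :: "real \<Rightarrow> 'a::real_normed_vector"
  assumes "(f has_vector_derivative D) (at (c * t))"
  shows "((\<lambda>t. f (c * t)) has_vector_derivative c *\<^sub>R D) (at t)"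
proof -
  have "((\<lambda>t. c * t) has_vector_derivative c) (at t)"
    by (auto intro!: derivative_eq_intros)
  from vector_diff_chain_at[OF this assms] show ?thesis
    by (simp add: o_def)
qed

section \<open>Curves generated by an idempotent matrix\<close>

text \<open>This is the exponential of \<open>t *\<^sub>R P\<close> for an idempotent \<open>P\<close>, see \<open>mexp_idem\<close>.\<close>

definition idempotent_flow :: "cmat \<Rightarrow> real \<Rightarrow> cmat" where
  "idempotent_flow P t = mat 1 + (exp t - 1) *\<^sub>R P"

lemma idempotent_flow_mult:
  assumes "P ** P = P"
  shows "idempotent_flow P s ** idempotent_flow P t = idempotent_flow P (s + t)"
proof -
  have "(mat 1 + x *\<^sub>R P) ** (mat 1 + y *\<^sub>R P) = mat 1 + (x + y + x * y) *\<^sub>R P" for x y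
    using assms by (simp add: matrix_mult_distribs scaleR_add_left scaleR_add_right mult.commute)
  then have "idempotent_flow P s ** idempotent_flow P t
      = mat 1 + ((exp s - 1) + (exp t - 1) + (exp s - 1) * (exp t - 1)) *\<^sub>R P"
    unfolding idempotent_flow_def .
  also have "(exp s - 1) + (exp t - 1) + (exp s - 1) * (exp t - 1) = exp (s + t) - 1"
    by (simp add: exp_add algebra_simps)
  finally show ?thesis
    by (simp add: idempotent_flow_def)
qed

lemma idempotent_flow_0 [simp]: "idempotent_flow P 0 = mat 1"
  by (simp add: idempotent_flow_def)

lemma idempotent_flow_mult_idem:
  assumes "P ** P = P"
  shows "idempotent_flow P t ** P = exp t *\<^sub>R P" "P ** idempotent_flow P t = exp t *\<^sub>R P"
  using assms by (simp_all add: idempotent_flow_def matrix_mult_distribs scaleR_left_diff_distrib)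

lemma idempotent_flow_has_vector_derivative:
  "(idempotent_flow P has_vector_derivative exp t *\<^sub>R P) (at t)"
  unfolding idempotent_flow_def by (auto intro!: derivative_eq_intros)

lemma locally_lipschitz_idempotent_flow: "locally_lipschitz (idempotent_flow P)"
  unfolding locally_lipschitz_def
proof
  fix t
  have "(exp (t + 1) * norm P)-lipschitz_on (cball t 1) (idempotent_flow P)"
  proof (rule bounded_derivative_imp_lipschitz)
    fix s assume s: "s \<in> cball t 1"
    show "(idempotent_flow P has_derivative (\<lambda>h. h *\<^sub>R (exp s *\<^sub>R P))) (at s within cball t 1)"
      using idempotent_flow_has_vector_derivative has_vector_derivative_at_within
      unfolding has_vector_derivative_def by blast
    show "onorm (\<lambda>h. h *\<^sub>R (exp s *\<^sub>R P)) \<le> exp (t + 1) * norm P"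
    proof (rule onorm_le)
      fix h
      have "exp s \<le> exp (t + 1)"
        using s by (auto simp: dist_real_def)
      then have "\<bar>h\<bar> * (exp s * norm P) \<le> \<bar>h\<bar> * (exp (t + 1) * norm P)"
        by (intro mult_left_mono mult_right_mono) auto
      then show "norm (h *\<^sub>R (exp s *\<^sub>R P)) \<le> exp (t + 1) * norm P * norm h"
        by (simp add: abs_mult mult_ac)
    qed
  qed auto
  then show "\<exists>\<epsilon>>0. \<exists>L. L-lipschitz_on (cball t \<epsilon>) (idempotent_flow P)"
    using zero_less_one by blast
qed

text \<open>Multiplying \<open>G\<close> by the inverse flow gives a curve with zero derivative almost everywhere.\<close>

lemma flow_unique:
  assumes P: "P ** P = P" and lip: "locally_lipschitz G"
    and deriv: "AE t in lebesgue. (G has_vector_derivative G t ** P) (at t)"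
  shows "G t = G 0 ** idempotent_flow P t"
proof -
  define F where "F = (\<lambda>t. G t ** idempotent_flow P (- t))"
  have "locally_lipschitz (\<lambda>t. idempotent_flow P (- t))"
    using locally_lipschitz_rescale[OF locally_lipschitz_idempotent_flow, of "-1"] by simp
  then have "locally_lipschitz F"
    unfolding F_def using lip by (intro locally_lipschitz_matrix_mult)
  moreover have "AE t in lebesgue. (F has_vector_derivative 0) (at t)"
    using deriv
  proof eventually_elim
    case (elim t)
    have "((\<lambda>t. idempotent_flow P (- t)) has_vector_derivative (- 1) *\<^sub>R (exp (- t) *\<^sub>R P)) (at t)"
      using has_vector_derivative_rescale[of "idempotent_flow P" _ "-1" t] idempotent_flow_has_vector_derivative
      by simp
    from bounded_bilinear.has_vector_derivative[OF bounded_bilinear_matrix_mult elim this]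
    show ?case
      unfolding F_def
      by (simp add: matrix_mult_distribs idempotent_flow_mult_idem[OF P] flip: matrix_mul_assoc)
  qed
  ultimately have "F t = F 0"
    by (rule locally_lipschitz_zero_derivative_constant)
  then have "G t ** (idempotent_flow P (- t) ** idempotent_flow P t) = G 0 ** idempotent_flow P t"
    by (simp add: F_def matrix_mul_assoc)
  then show ?thesis
    by (simp add: idempotent_flow_mult[OF P])
qed

text \<open>All positive powers of \<open>s *\<^sub>R P\<close> are multiples of \<open>P\<close>, so the series is a scalar exponential series,
  up to its constant term.\<close>

lemma mexp_idem:
  assumes P: "P ** P = P"
  shows "mexp (s *\<^sub>R P) = idempotent_flow P s"
proof -
  have pow: "((**) (s *\<^sub>R P) ^^ n) (mat 1) = (if n = 0 then mat 1 - P else 0) + s ^ n *\<^sub>R P" for n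
    by (induction n) (auto simp: matrix_mult_distribs P)
  have "(\<lambda>n. if n = 0 then mat 1 - P else 0) sums (mat 1 - P)"
    by (rule sums_single)
  moreover have "(\<lambda>n. (s ^ n /\<^sub>R fact n) *\<^sub>R P) sums (exp s *\<^sub>R P)"
    by (rule bounded_linear.sums[OF bounded_linear_scaleR_left exp_converges])
  ultimately have "(\<lambda>n. (if n = 0 then mat 1 - P else 0) + (s ^ n /\<^sub>R fact n) *\<^sub>R P)
      sums ((mat 1 - P) + exp s *\<^sub>R P)"
    by (rule sums_add)
  moreover have "(\<lambda>n. (if n = 0 then mat 1 - P else 0) + (s ^ n /\<^sub>R fact n) *\<^sub>R P)
      = (\<lambda>n. (1 / fact n) *\<^sub>R ((**) (s *\<^sub>R P) ^^ n) (mat 1))"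
    unfolding pow by (auto simp: scaleR_add_right divide_inverse mult.commute)
  ultimately show ?thesis
    unfolding mexp_def idempotent_flow_def
    by (simp add: sums_unique[symmetric] scaleR_left_diff_distrib)
qed

section \<open>Pauli coordinates\<close>

text \<open>The matrices \<open>e1\<close>, \<open>e2\<close>, \<open>e3\<close> are half the Pauli matrices, with the sign of the second one reversed.\<close>

definition pauli :: "real^3 \<Rightarrow> cmat" where
  "pauli x = x $ 1 *\<^sub>R e1 + x $ 2 *\<^sub>R e2 + x $ 3 *\<^sub>R e3"

lemma matrix_2_eq_iff: "A = B \<longleftrightarrow> A $ 1 $ 1 = B $ 1 $ 1 \<and> A $ 1 $ 2 = B $ 1 $ 2
    \<and> A $ 2 $ 1 = B $ 2 $ 1 \<and> A $ 2 $ 2 = B $ 2 $ 2" for A B :: cmat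
  by (auto simp: vec_eq_iff forall_2)

lemma e0_entries [simp]: "e0 $ 1 $ 1 = 1/2" "e0 $ 1 $ 2 = 0" "e0 $ 2 $ 1 = 0" "e0 $ 2 $ 2 = 1/2"
  by (simp_all add: e0_def mat_def complex_eq_iff)

lemma pauli_entries [simp]:
  "pauli x $ 1 $ 1 = Complex (x $ 3 / 2) 0" "pauli x $ 1 $ 2 = Complex (x $ 1 / 2) (x $ 2 / 2)"
  "pauli x $ 2 $ 1 = Complex (x $ 1 / 2) (- x $ 2 / 2)" "pauli x $ 2 $ 2 = Complex (- x $ 3 / 2) 0"
  by (simp_all add: pauli_def e1_def e2_def e3_def complex_eq_iff)

lemma mult_entries: "((A :: cmat) ** B) $ i $ j = A $ i $ 1 * B $ 1 $ j + A $ i $ 2 * B $ 2 $ j"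
  by (simp add: matrix_matrix_mult_def sum_2)

lemma mat_i_entries [simp]:
  "(mat \<i> :: cmat) $ 1 $ 1 = \<i>" "(mat \<i> :: cmat) $ 1 $ 2 = 0"
  "(mat \<i> :: cmat) $ 2 $ 1 = 0" "(mat \<i> :: cmat) $ 2 $ 2 = \<i>"
  by (simp_all add: mat_def)

lemma pauli_scaleR: "pauli (r *\<^sub>R x) = r *\<^sub>R pauli x"
  by (simp add: pauli_def scaleR_add_right)

lemma linear_pauli: "linear pauli"
  by (rule linearI) (simp_all add: pauli_def scaleR_add_left scaleR_add_right)

lemma linear_i_pauli: "linear (\<lambda>x. mat \<i> ** pauli x)"
  by (rule linearI) (simp_all add: linear_add[OF linear_pauli] pauli_scaleR matrix_mult_distribs)

lemma pauli_0 [simp]: "pauli 0 = 0"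
  using linear_0[OF linear_pauli] .

lemma Herm_cases:
  assumes "h \<in> Herm"
  obtains x where "h = coord0 h *\<^sub>R e0 + pauli x"
proof -
  obtain a b c d where h: "h = a *\<^sub>R e0 + b *\<^sub>R e1 + c *\<^sub>R e2 + d *\<^sub>R e3"
    using assms Herm_iff by blast
  then have "h = coord0 h *\<^sub>R e0 + pauli (vector [b, c, d])"
    using coord_combination(1)[of a b c d] by (simp add: pauli_def add.assoc)
  then show thesis by (rule that)
qed

lemma e0_plus_pauli_in_Herm [simp]: "a *\<^sub>R e0 + pauli x \<in> Herm"
  unfolding Herm_iff pauli_def
  by (intro exI[of _ a] exI[of _ "x $ 1"] exI[of _ "x $ 2"] exI[of _ "x $ 3"]) (simp add: add.assoc)

lemma pauli_in_Herm [simp]: "pauli x \<in> Herm"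
  using e0_plus_pauli_in_Herm[of 0 x] by simp

lemma coords_pauli [simp]:
  "coord0 (a *\<^sub>R e0 + pauli x) = a" "coord1 (a *\<^sub>R e0 + pauli x) = x $ 1"
  "coord2 (a *\<^sub>R e0 + pauli x) = x $ 2" "coord3 (a *\<^sub>R e0 + pauli x) = x $ 3"
  by (simp_all add: coord0_def coord1_def coord2_def coord3_def)

lemma inner_real3: "x \<bullet> y = x $ 1 * y $ 1 + x $ 2 * y $ 2 + x $ 3 * y $ 3" for x y :: "real^3"
  by (simp add: inner_vec_def sum_3)

lemma pseudo_prod_pauli:
  "pseudo_prod (a *\<^sub>R e0 + pauli x) (b *\<^sub>R e0 + pauli y) = a * b - x \<bullet> y"
  by (simp add: pseudo_prod_def inner_real3)

lemma pseudo_prod_e0: "pseudo_prod h e0 = coord0 h"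
  by (simp add: pseudo_prod_def coord0_def coord1_def coord2_def coord3_def)

lemma W_iff: "w \<in> W \<longleftrightarrow> (\<exists>x. x \<bullet> x = 1 \<and> w = pauli x)"
proof
  assume "w \<in> W"
  then have w: "w \<in> Herm" "coord0 w = 0" "pseudo_prod w w = - 1"
    by (simp_all add: W_def pseudo_prod_e0)
  obtain x where "w = coord0 w *\<^sub>R e0 + pauli x"
    using w(1) by (rule Herm_cases)
  then show "\<exists>x. x \<bullet> x = 1 \<and> w = pauli x"
    using w(2,3) pseudo_prod_pauli[of 0 x 0 x] by auto
next
  assume "\<exists>x. x \<bullet> x = 1 \<and> w = pauli x"
  then show "w \<in> W"
    using pseudo_prod_pauli[of 0 _ 0 _] coords_pauli(1)[of 0] by (auto simp: W_def pseudo_prod_e0)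
qed

lemma isotropic_normal_form:
  assumes "X \<in> Herm" "pseudo_prod X X = 0" "coord0 X \<noteq> 0"
  obtains x where "x \<bullet> x = 1" "X = coord0 X *\<^sub>R (e0 + pauli x)"
proof -
  obtain y where y: "X = coord0 X *\<^sub>R e0 + pauli y"
    using assms(1) by (rule Herm_cases)
  have "y \<bullet> y = coord0 X * coord0 X"
    using assms(2) pseudo_prod_pauli[of "coord0 X" y "coord0 X" y] y by simp
  show thesis
  proof
    show "(1 / coord0 X) *\<^sub>R y \<bullet> (1 / coord0 X) *\<^sub>R y = 1"
      using \<open>y \<bullet> y = _\<close> assms(3) by simp
    show "X = coord0 X *\<^sub>R (e0 + pauli ((1 / coord0 X) *\<^sub>R y))"
      using y assms(3) by (simp add: pauli_scaleR scaleR_add_right)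
  qed
qed

text \<open>The matrix has trace 1 and determinant 0, so this is its Cayley-Hamilton equation.\<close>

lemma light_like_idempotent:
  assumes "x \<bullet> x = 1"
  shows "(e0 + pauli x) ** (e0 + pauli x) = e0 + pauli x"
proof -
  have "x $ 3 * x $ 3 = 1 - x $ 1 * x $ 1 - x $ 2 * x $ 2"
    using assms by (simp add: inner_real3)
  then show ?thesis
    by (simp add: matrix_2_eq_iff mult_entries complex_eq_iff field_simps)
qed

lemma commutator_e0_plus [simp]: "commutator (a *\<^sub>R e0 + B) C = commutator B C"
  by (simp add: commutator_def e0_def matrix_mult_distribs)

text \<open>The arguments of the cross product are in reversed order because of the sign of \<open>e2\<close>.\<close>

lemma commutator_pauli: "commutator (pauli x) (pauli y) = mat \<i> ** pauli (cross3 y x)"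
  by (simp add: commutator_def matrix_2_eq_iff mult_entries complex_eq_iff
      cross3_def field_simps)

lemma commutator_pauli_i:
  "commutator (pauli x) (mat \<i> ** pauli y) = pauli (cross3 x y)"
  by (simp add: commutator_def matrix_2_eq_iff mult_entries complex_eq_iff
      cross3_def field_simps)

lemma pauli_in_glp [simp]: "pauli x \<in> glp" "mat \<i> ** pauli x \<in> glp" "e0 \<in> glp"
  by (simp_all add: glp_def trace_def sum_2 mult_entries complex_is_Real_iff)

lemma glp_scaleR: "v \<in> glp \<Longrightarrow> c *\<^sub>R v \<in> glp"
  by (auto simp: glp_def trace_def sum_2 complex_is_Real_iff simp flip: distrib_left)

lemma glp_add: "v \<in> glp \<Longrightarrow> w \<in> glp \<Longrightarrow> v + w \<in> glp"
  by (auto simp: glp_def trace_def sum_2 complex_is_Real_iff)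

lemma glp_cases:
  assumes "v \<in> glp"
  obtains a x y where "v = a *\<^sub>R e0 + pauli x + mat \<i> ** pauli y"
proof
  define p q r s where "p = v $ 1 $ 1" "q = v $ 1 $ 2" "r = v $ 2 $ 1" "s = v $ 2 $ 2"
  note d = this
  have "Im s = - Im p"
    using assms by (simp add: glp_def trace_def sum_2 complex_is_Real_iff d)
  then show "v = (Re p + Re s) *\<^sub>R e0 + pauli (vector [Re q + Re r, Im q - Im r, Re p - Re s])
      + mat \<i> ** pauli (vector [Im q + Im r, Re r - Re q, 2 * Im p])"
    by (simp add: matrix_2_eq_iff mult_entries complex_eq_iff d[symmetric] field_simps)
qed

lemma commutator_Herm_i_pauli:
  assumes "h \<in> Herm"
  shows "commutator h (mat \<i> ** pauli y) \<in> Herm"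
proof -
  obtain x where "h = coord0 h *\<^sub>R e0 + pauli x"
    using assms by (rule Herm_cases)
  then show ?thesis
    by (metis commutator_e0_plus commutator_pauli_i pauli_in_Herm)
qed

section \<open>Covectors of an extremal\<close>

lemma abs_continuous_const: "abs_continuous_on_interval a b (\<lambda>t. k)"
  unfolding abs_continuous_on_interval_def by (auto intro: exI[of _ 1])

lemma covector_0: "covector f \<Longrightarrow> f 0 = 0"
  using glp_scaleR[of e0 0] unfolding covector_def by (metis mult_zero_left pauli_in_glp(3) scaleR_zero_left)

lemma covector_as_inner:
  fixes L :: "real^3 \<Rightarrow> cmat"
  assumes "covector f" "linear L" "\<And>x. L x \<in> glp"
  obtains p where "\<And>y. f (L y) = p \<bullet> y"
proof
  have "linear (\<lambda>y. f (L y))"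
    using assms unfolding covector_def
    by (intro linearI) (simp_all add: linear_add linear_scale)
  then show "f (L y) = adjoint (\<lambda>y. f (L y)) 1 \<bullet> y" for y
    using adjoint_works[of "\<lambda>y. f (L y)" y 1] by (simp add: inner_commute)
qed

text \<open>On traceless Hermitian matrices \<open>f\<close> is the inner product with some vector \<open>p\<close>.  Its minimum on
  the unit sphere is \<open>- norm p\<close>, so \<open>norm p = 1\<close>, and equality in the Cauchy-Schwarz inequality
  forces \<open>p = - x\<close>.\<close>

lemma minimiser_on_W:
  assumes f: "covector f" and min: "is_arg_min f (\<lambda>w. w \<in> W) w" and "f w = - 1"
  obtains x where "x \<bullet> x = 1" "w = pauli x" "\<And>y. f (pauli y) = - (x \<bullet> y)"
proof -
  obtain p where p: "\<And>y. f (pauli y) = p \<bullet> y"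
    using covector_as_inner[OF f linear_pauli] pauli_in_glp by blast
  obtain x where x: "x \<bullet> x = 1" "w = pauli x"
    using min W_iff by (auto simp: is_arg_min_def)
  have px: "p \<bullet> x = - 1"
    using \<open>f w = - 1\<close> p x by simp
  then have "p \<noteq> 0"
    by auto
  \<comment> \<open>The minimum point of \<open>f\<close> on the sphere; comparing with it gives \<open>norm p \<le> 1\<close>.\<close>
  define y where "y = - (1 / norm p) *\<^sub>R p"
  have "y \<bullet> y = 1"
    using \<open>p \<noteq> 0\<close> by (simp add: y_def dot_square_norm power2_eq_square)
  then have "pauli y \<in> W"
    using W_iff by blast
  then have "- 1 \<le> f (pauli y)"
    using min \<open>f w = - 1\<close> by (simp add: is_arg_min_linorder)
  also have "f (pauli y) = - norm p"
    using \<open>p \<noteq> 0\<close> by (simp add: p y_def dot_square_norm power2_eq_square)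
  finally have "p \<bullet> p \<le> 1"
    by (simp add: dot_square_norm power_le_one)
  then have "(p + x) \<bullet> (p + x) \<le> 0"
    using px x(1) by (simp add: inner_add_left inner_add_right inner_commute)
  then have "p = - x"
    using inner_ge_zero[of "p + x"] by (simp add: eq_neg_iff_add_eq_0)
  then show thesis
    using that x p by simp
qed

lemma parallel_unit:
  assumes "cross3 x q = 0" "q \<noteq> 0"
  shows "x = ((x \<bullet> q) / (q \<bullet> q)) *\<^sub>R q"
proof -
  have "cross3 q (cross3 x q) = (q \<bullet> q) *\<^sub>R x - (q \<bullet> x) *\<^sub>R q"
    by (simp add: vec_eq_iff forall_3 cross3_def inner_real3 algebra_simps)
  then have "(q \<bullet> q) *\<^sub>R x = (x \<bullet> q) *\<^sub>R q"
    using assms(1) by (simp add: inner_commute)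
  then have "(1 / (q \<bullet> q)) *\<^sub>R ((q \<bullet> q) *\<^sub>R x) = (1 / (q \<bullet> q)) *\<^sub>R ((x \<bullet> q) *\<^sub>R q)"
    by simp
  then show ?thesis
    using assms(2) by simp
qed

lemma left_mult_cancel:
  fixes A B C :: cmat
  assumes "A \<in> GLp" "A ** B = A ** C"
  shows "B = C"
proof -
  have "invertible A"
    using assms(1) by (auto simp: GLp_def invertible_det_nz)
  then obtain A' where "A' ** A = mat 1"
    unfolding invertible_def by blast
  then show ?thesis
    using arg_cong[OF assms(2), of "(**) A'"] by (simp add: matrix_mul_assoc)
qed

lemma control_unique:
  assumes "g t \<in> GLp" "(g has_vector_derivative g t ** x) (at t)"
    and "(g has_vector_derivative g t ** y) (at t)"
  shows "x = y"
  using left_mult_cancel[OF assms(1)] vector_derivative_unique_at[OF assms(2,3)] .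

section \<open>Nonstrictly abnormal extremals are shifted subgroups\<close>

text \<open>The commutator of a Hermitian matrix with \<open>\<i>\<close> times a Hermitian matrix is Hermitian, where \<open>\<psi>\<close>
  vanishes; so the adjoint equation makes the values of \<open>\<psi>\<close> on such multiples constant in time.\<close>

lemma abnormal_covector_constant:
  assumes ac: "abs_continuous_covector \<psi>" and vanish: "\<And>t h. h \<in> Herm \<Longrightarrow> \<psi> t h = 0"
    and adj: "adjoint_equation u \<psi>" and u: "AE t in lebesgue. u t \<in> Herm"
    and nonzero: "v \<in> glp" "\<psi> 0 v \<noteq> 0"
  obtains q where "q \<noteq> 0" "\<And>t y. \<psi> t (mat \<i> ** pauli y) = q \<bullet> y"
proof -
  have cov: "covector (\<psi> t)" for t
    using ac by (simp add: abs_continuous_covector_def)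
  obtain q where q: "\<And>y. \<psi> 0 (mat \<i> ** pauli y) = q \<bullet> y"
    using covector_as_inner[OF cov linear_i_pauli] pauli_in_glp by blast
  have "\<psi> t (mat \<i> ** pauli y) = \<psi> 0 (mat \<i> ** pauli y)" for t y
  proof (rule zero_AE_derivative_constant[where f = "\<lambda>t. \<psi> t (mat \<i> ** pauli y)"])
    show "abs_continuous_on_interval a b (\<lambda>t. \<psi> t (mat \<i> ** pauli y))" for a b
      using ac by (simp add: abs_continuous_covector_def)
    show "AE t in lebesgue. ((\<lambda>t. \<psi> t (mat \<i> ** pauli y)) has_real_derivative 0) (at t)"
      using adj[unfolded adjoint_equation_def] u
    proof eventually_elim
      case (elim t)
      then show ?case
        using vanish[OF commutator_Herm_i_pauli] pauli_in_glp(2) by metis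
    qed
  qed
  moreover obtain a x y where v: "v = a *\<^sub>R e0 + pauli x + mat \<i> ** pauli y"
    using nonzero(1) by (rule glp_cases)
  have "\<psi> 0 v = \<psi> 0 (a *\<^sub>R e0 + pauli x) + \<psi> 0 (mat \<i> ** pauli y)"
    unfolding v using cov[of 0] by (simp add: covector_def glp_add glp_scaleR)
  then have "q \<noteq> 0"
    using nonzero(2) vanish q by auto
  ultimately show thesis
    using that q by simp
qed

text \<open>On Hermitian matrices \<open>\<psi>\<close> is constantly 0, so the right-hand side of the adjoint equation must be 0
  there too; by \<open>commutator_pauli\<close> this says that \<open>q\<close> is orthogonal to every \<open>cross3 y x\<close>.
  The factor \<open>c\<close> accounts for the change of parameter in the definition of normal extremals: the
  control \<open>e0 + pauli x\<close> is the one after the change.\<close>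

lemma abnormal_direction:
  assumes vanish: "\<And>t h. h \<in> Herm \<Longrightarrow> \<psi> t h = 0"
    and q: "\<And>y. \<psi> t (mat \<i> ** pauli y) = q \<bullet> y"
    and adj: "\<And>v. v \<in> glp \<Longrightarrow> ((\<lambda>s. \<psi> s v) has_real_derivative \<psi> t (commutator h v)) (at t)"
    and h: "c *\<^sub>R h = e0 + pauli x" "c \<noteq> 0"
  shows "cross3 x q = 0"
proof -
  have h': "h = (1 / c) *\<^sub>R e0 + pauli ((1 / c) *\<^sub>R x)"
    using arg_cong[OF h(1), of "\<lambda>m. (1 / c) *\<^sub>R m"] h(2) by (simp add: pauli_scaleR scaleR_add_right)
  have "q \<bullet> cross3 y x = 0" for y
  proof -
    have "(\<lambda>s. \<psi> s (pauli y)) = (\<lambda>s. 0)"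
      using vanish by simp
    then have "\<psi> t (commutator h (pauli y)) = 0"
      using DERIV_unique[OF adj[OF pauli_in_glp(1)], of y] by (metis DERIV_const)
    moreover have "commutator h (pauli y) = mat \<i> ** pauli (cross3 y ((1 / c) *\<^sub>R x))"
      unfolding h' by (simp only: commutator_e0_plus commutator_pauli)
    ultimately show ?thesis
      using q h(2) by (simp add: cross_mult_right)
  qed
  then have "cross3 x q \<bullet> cross3 x q = 0"
    by (metis cross_triple inner_commute)
  then show ?thesis by simp
qed

text \<open>The value of the normal covector at \<open>pauli q\<close> is a first integral, because \<open>pauli q\<close> commutes with
  the control.  It fixes the control within the line spanned by \<open>q\<close>.\<close>

lemma nonstrictly_abnormal_imp_shifted_subgroup:
  assumes normal: "normal_isotropic_extremal g" and abnormal: "abnormal_isotropic_extremal g"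
  obtains X where "X \<in> Herm" "X \<noteq> 0" "pseudo_prod X X = 0" "g 0 \<in> GLp"
    "g = (\<lambda>t. left_shift (g 0) (one_param_subgroup X t))"
proof -
  have g: "\<And>t. g t \<in> GLp" "locally_lipschitz g"
    using normal by (auto simp: normal_isotropic_extremal_def isotropic_curve_def)
  obtain c w \<psi> where "c > 0" and ctrl: "control_of (\<lambda>t. g (c * t)) (\<lambda>t. e0 + w t)"
    and ac: "abs_continuous_covector \<psi>" and adj: "adjoint_equation (\<lambda>t. e0 + w t) \<psi>"
    and min: "AE t in lebesgue. is_arg_min (\<psi> t) (\<lambda>x. x \<in> W) (w t) \<and> \<psi> t (w t) = - 1"
    using normal unfolding normal_isotropic_extremal_def by blast
  obtain u \<phi> where ctrl': "control_of g u" and ac': "abs_continuous_covector \<phi>"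
    and nonzero: "\<forall>t. \<exists>v\<in>glp. \<phi> t v \<noteq> 0"
    and vanish: "\<And>t h. h \<in> Herm \<Longrightarrow> \<phi> t h = 0" and adj': "adjoint_equation u \<phi>"
    using abnormal unfolding abnormal_isotropic_extremal_def by blast
  have cov: "covector (\<psi> t)" for t
    using ac by (simp add: abs_continuous_covector_def)
  have u: "AE t in lebesgue. u t \<in> Herm"
    using ctrl' by (auto simp: control_of_def elim: eventually_mono)
  obtain v where v: "v \<in> glp" "\<phi> 0 v \<noteq> 0"
    using nonzero by blast
  obtain q where "q \<noteq> 0" and q: "\<And>t y. \<phi> t (mat \<i> ** pauli y) = q \<bullet> y"
    using abnormal_covector_constant[OF ac' vanish adj' u v] by blast
  have deriv: "AE t in lebesgue. ((\<lambda>t. g (c * t)) has_vector_derivative g (c * t) ** (e0 + w t)) (at t)"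
    using ctrl by (auto simp: control_of_def left_shift_def elim: eventually_mono)
  have "AE t in lebesgue. (g has_vector_derivative g t ** u t) (at t) \<and>
      (\<forall>v\<in>glp. ((\<lambda>s. \<phi> s v) has_real_derivative \<phi> t (commutator (u t) v)) (at t))"
    using ctrl' adj' by (auto simp: control_of_def adjoint_equation_def left_shift_def
        elim: eventually_elim2)
  \<comment> \<open>The normal covector lives on the rescaled time axis, so the abnormal data are pulled back to it.\<close>
  from AE_lebesgue_rescale[OF this, of c]
  have "AE t in lebesgue. (g has_vector_derivative g (c * t) ** u (c * t)) (at (c * t)) \<and>
      (\<forall>v\<in>glp. ((\<lambda>s. \<phi> s v) has_real_derivative \<phi> (c * t) (commutator (u (c * t)) v)) (at (c * t)))"
    using \<open>c > 0\<close> by simp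
  then have dir: "AE t in lebesgue. \<exists>x. x \<bullet> x = 1 \<and> w t = pauli x \<and> cross3 x q = 0 \<and>
      (\<forall>y. \<psi> t (pauli y) = - (x \<bullet> y))"
    using deriv min
  proof eventually_elim
    case (elim t)
    obtain x where x: "x \<bullet> x = 1" "w t = pauli x" "\<And>y. \<psi> t (pauli y) = - (x \<bullet> y)"
      using minimiser_on_W[OF cov[of t]] elim by blast
    have "((\<lambda>t. g (c * t)) has_vector_derivative c *\<^sub>R (g (c * t) ** u (c * t))) (at t)"
      using elim by (intro has_vector_derivative_rescale) simp
    then have "((\<lambda>t. g (c * t)) has_vector_derivative g (c * t) ** (c *\<^sub>R u (c * t))) (at t)"
      by (simp add: matrix_mult_distribs)
    then have "c *\<^sub>R u (c * t) = e0 + pauli x"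
      using control_unique[of "\<lambda>t. g (c * t)" t] g(1) elim x(2) by metis
    then have "cross3 x q = 0"
      using abnormal_direction[of \<phi> "c * t" q "u (c * t)" c x] vanish q elim \<open>c > 0\<close> by auto
    then show ?case
      using x by blast
  qed
  have const: "\<psi> t (pauli q) = \<psi> 0 (pauli q)" for t
  proof (rule zero_AE_derivative_constant[where f = "\<lambda>t. \<psi> t (pauli q)"])
    show "abs_continuous_on_interval a b (\<lambda>t. \<psi> t (pauli q))" for a b
      using ac by (simp add: abs_continuous_covector_def)
    show "AE t in lebesgue. ((\<lambda>t. \<psi> t (pauli q)) has_real_derivative 0) (at t)"
      using adj[unfolded adjoint_equation_def] dir
    proof eventually_elim
      case (elim t)
      then obtain x where x: "w t = pauli x" "cross3 x q = 0"
        by blast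
      have "commutator (e0 + w t) (pauli q) = commutator (pauli x) (pauli q)"
        using commutator_e0_plus[of 1] x by simp
      also have "\<dots> = 0"
        using x(2) cross_skew[of q x] by (simp add: commutator_pauli matrix_mult_distribs)
      finally show ?case
        using elim covector_0[OF cov] pauli_in_glp(1) by metis
    qed
  qed
  \<comment> \<open>The constant control: the only multiple of \<open>q\<close> whose inner product with \<open>q\<close> is minus the first
    integral.\<close>
  define x where "x = (- \<psi> 0 (pauli q) / (q \<bullet> q)) *\<^sub>R q"
  have w: "AE t in lebesgue. x \<bullet> x = 1 \<and> w t = pauli x"
    using dir
  proof eventually_elim
    case (elim t)
    then obtain z where z: "z \<bullet> z = 1" "w t = pauli z" "cross3 z q = 0"
      "\<And>y. \<psi> t (pauli y) = - (z \<bullet> y)"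
      by blast
    then have "z \<bullet> q = - \<psi> 0 (pauli q)"
      using const[of t] by simp
    then have "z = x"
      using parallel_unit[OF z(3) \<open>q \<noteq> 0\<close>] by (simp add: x_def)
    then show ?case
      using z by simp
  qed
  define P where "P = e0 + pauli x"
  have "x \<bullet> x = 1"
    using AE_lebesgue_imp_ex[OF w] by blast
  then have P: "P ** P = P"
    unfolding P_def by (rule light_like_idempotent)
  have flow: "g (c * t) = g 0 ** idempotent_flow P t" for t
  proof -
    have "AE t in lebesgue. ((\<lambda>t. g (c * t)) has_vector_derivative g (c * t) ** P) (at t)"
      using deriv w by eventually_elim (simp add: P_def)
    from flow_unique[OF P _ this, of t] show ?thesis
      using locally_lipschitz_rescale[OF g(2)] \<open>c > 0\<close> by simp
  qed
  define X where "X = (1 / c) *\<^sub>R P"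
  have X: "X = (1 / c) *\<^sub>R e0 + pauli ((1 / c) *\<^sub>R x)"
    by (simp add: X_def P_def scaleR_add_right pauli_scaleR)
  show thesis
  proof
    show "X \<in> Herm"
      unfolding X by simp
    have "coord0 X = 1 / c"
      unfolding X by simp
    then show "X \<noteq> 0"
      using \<open>c > 0\<close> by (auto simp: coord0_def)
    show "pseudo_prod X X = 0"
      unfolding X pseudo_prod_pauli using \<open>x \<bullet> x = 1\<close> by simp
    show "g = (\<lambda>t. left_shift (g 0) (one_param_subgroup X t))"
    proof
      fix t
      have "one_param_subgroup X t = idempotent_flow P (t / c)"
        using mexp_idem[OF P, of "t / c"] by (simp add: one_param_subgroup_def X_def)
      then show "g t = left_shift (g 0) (one_param_subgroup X t)"
        using flow[of "t / c"] \<open>c > 0\<close> by (simp add: left_shift_def)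
    qed
  qed (rule g)
qed

section \<open>Isotropic subgroups are nonstrictly abnormal\<close>

text \<open>Infinitesimal invariance of the functional \<open>tr (_ ** B)\<close> under conjugation by matrices that
  commute with \<open>B\<close>: the reason why covectors of this form are stationary.\<close>

lemma trace_commutator:
  fixes u v B :: cmat
  assumes "B ** u = u ** B"
  shows "trace (commutator u v ** B) = 0"
proof -
  have "trace (u ** v ** B) = trace (v ** B ** u)"
    using trace_mul_sym[of u "v ** B"] by (simp add: matrix_mul_assoc)
  also have "\<dots> = trace (v ** u ** B)"
    using assms by (simp flip: matrix_mul_assoc)
  finally show ?thesis
    by (simp add: commutator_def matrix_mult_distribs trace_sub)
qed

lemma stationary_covector:
  assumes f: "covector f" and comm: "\<And>v. f (commutator h v) = 0"
  shows "abs_continuous_covector (\<lambda>t. f)" "adjoint_equation (\<lambda>t. h) (\<lambda>t. f)"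
  using f comm by (simp_all add: abs_continuous_covector_def adjoint_equation_def abs_continuous_const)

definition normal_covector :: "real^3 \<Rightarrow> cmat \<Rightarrow> real" where
  "normal_covector x v = 2 * Re (trace (v ** (e0 - pauli x)))"

definition abnormal_covector :: "real^3 \<Rightarrow> cmat \<Rightarrow> real" where
  "abnormal_covector x v = Im (trace (v ** pauli x))"

lemma covector_witnesses: "covector (normal_covector x)" "covector (abnormal_covector x)"
  by (simp_all add: covector_def normal_covector_def abnormal_covector_def matrix_mult_distribs
      trace_add trace_def sum_2 algebra_simps)

lemma witnesses_commutator:
  "normal_covector x (commutator (r *\<^sub>R (e0 + pauli x)) v) = 0"
  "abnormal_covector x (commutator (r *\<^sub>R (e0 + pauli x)) v) = 0"
proof -
  have e0_comm: "e0 ** A = A ** e0" for A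
    by (simp add: e0_def matrix_mult_distribs)
  define h where "h = r *\<^sub>R (e0 + pauli x)"
  have pauli_comm: "pauli x ** h = h ** pauli x"
    by (simp add: h_def matrix_mult_distribs e0_comm)
  then have "(e0 - pauli x) ** h = h ** (e0 - pauli x)"
    by (simp add: matrix_mult_distribs e0_comm)
  from trace_commutator[OF this] trace_commutator[OF pauli_comm]
  show "normal_covector x (commutator (r *\<^sub>R (e0 + pauli x)) v) = 0"
    "abnormal_covector x (commutator (r *\<^sub>R (e0 + pauli x)) v) = 0"
    by (simp_all add: normal_covector_def abnormal_covector_def flip: h_def)
qed

lemma normal_covector_values: "normal_covector x e0 = 1" "normal_covector x (pauli y) = - (x \<bullet> y)"
  by (simp_all add: normal_covector_def trace_def sum_2 mult_entries inner_real3 field_simps)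

lemma normal_covector_min:
  assumes "x \<bullet> x = 1"
  shows "is_arg_min (normal_covector x) (\<lambda>w. w \<in> W) (pauli x)"
proof -
  have "x \<bullet> y \<le> 1" if "y \<bullet> y = 1" for y
    using norm_cauchy_schwarz[of x y] assms that by (simp add: norm_eq_sqrt_inner)
  then show ?thesis
    using assms by (auto simp: is_arg_min_linorder W_iff normal_covector_values)
qed

lemma abnormal_covector_values:
  "h \<in> Herm \<Longrightarrow> abnormal_covector x h = 0"
  "abnormal_covector x (mat \<i> ** pauli y) = (x \<bullet> y) / 2"
proof -
  show "abnormal_covector x h = 0" if hH: "h \<in> Herm"
  proof -
    obtain a y where h: "h = a *\<^sub>R e0 + pauli y"
      using Herm_cases[OF hH] by blast
    show ?thesis
      by (simp add: h abnormal_covector_def trace_def sum_2 mult_entries field_simps)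
  qed
  show "abnormal_covector x (mat \<i> ** pauli y) = (x \<bullet> y) / 2"
    by (simp add: abnormal_covector_def trace_def sum_2 mult_entries inner_real3 field_simps)
qed

text \<open>The horizontal curve \<open>g\<close> has only one control up to null sets, namely the constant \<open>X\<close>; as \<open>g\<close> is
  future directed, \<open>coord0 X > 0\<close>, so \<open>X\<close> becomes \<open>e0 + pauli x\<close> after a proportional change of
  parameter.\<close>

lemma isotropic_subgroup_nonstrictly_abnormal:
  assumes X: "X \<in> Herm" "X \<noteq> 0" "pseudo_prod X X = 0" and curve: "isotropic_curve g"
    and g: "g = (\<lambda>t. a ** one_param_subgroup X t)"
  shows "nonstrictly_abnormal g"
proof -
  have GLp: "g t \<in> GLp" for t
    using curve by (auto simp: isotropic_curve_def)
  have "coord0 X \<noteq> 0"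
  proof
    assume "coord0 X = 0"
    moreover obtain y where "X = coord0 X *\<^sub>R e0 + pauli y"
      using X(1) by (rule Herm_cases)
    ultimately have "y \<bullet> y = 0"
      using X(3) pseudo_prod_pauli[of 0 y 0 y] by simp
    then show False
      using X(2) \<open>X = _\<close> \<open>coord0 X = 0\<close> by simp
  qed
  then obtain x where x: "x \<bullet> x = 1" and X': "X = coord0 X *\<^sub>R (e0 + pauli x)"
    using isotropic_normal_form[OF X(1,3)] by blast
  define \<tau> P where "\<tau> = coord0 X" and "P = e0 + pauli x"
  have X_eq: "X = \<tau> *\<^sub>R P"
    using X' unfolding \<tau>_def P_def .
  have P: "P ** P = P"
    unfolding P_def using x by (rule light_like_idempotent)
  have g_flow: "g t = a ** idempotent_flow P (\<tau> * t)" for t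
    using mexp_idem[OF P, of "\<tau> * t"]
    by (simp add: g one_param_subgroup_def X_eq mult.commute)
  have deriv: "((\<lambda>t. g (r * t)) has_vector_derivative g (r * t) ** ((\<tau> * r) *\<^sub>R P)) (at t)" for r t
  proof -
    have "((\<lambda>t. idempotent_flow P (\<tau> * r * t)) has_vector_derivative
        (\<tau> * r) *\<^sub>R (idempotent_flow P (\<tau> * r * t) ** P)) (at t)"
      unfolding idempotent_flow_mult_idem[OF P]
      by (rule has_vector_derivative_rescale[OF idempotent_flow_has_vector_derivative])
    from bounded_bilinear.has_vector_derivative[OF bounded_bilinear_matrix_mult
        has_vector_derivative_const[of a] this]
    show ?thesis
      by (simp add: g_flow matrix_mult_distribs matrix_mul_assoc mult.assoc)
  qed
  have deriv1: "(g has_vector_derivative g t ** X) (at t)" for t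
    using deriv[of 1] by (simp add: X_eq)
  obtain u where u: "control_of g u" "AE t in lebesgue. pseudo_prod (u t) e0 > 0"
    using curve by (auto simp: isotropic_curve_def elim: eventually_mono)
  have "AE t in lebesgue. (g has_vector_derivative g t ** u t) (at t) \<and> pseudo_prod (u t) e0 > 0"
    using u by (auto simp: control_of_def left_shift_def elim: eventually_elim2)
  then obtain t where "(g has_vector_derivative g t ** u t) (at t)" "pseudo_prod (u t) e0 > 0"
    using AE_lebesgue_imp_ex by blast
  then have "\<tau> > 0"
    using control_unique[OF GLp _ deriv1, of t "u t"] by (simp add: pseudo_prod_e0 \<tau>_def)
  have "normal_isotropic_extremal g"
    unfolding normal_isotropic_extremal_def
  proof (intro conjI exI)
    show "control_of (\<lambda>t. g (1 / \<tau> * t)) (\<lambda>t. e0 + pauli x)"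
      using deriv[of "1 / \<tau>"] \<open>\<tau> > 0\<close> e0_plus_pauli_in_Herm[of 1 x]
      by (simp add: control_of_def left_shift_def P_def)
    show "adjoint_equation (\<lambda>t. e0 + pauli x) (\<lambda>t. normal_covector x)"
      "abs_continuous_covector (\<lambda>t. normal_covector x)"
      using stationary_covector[OF covector_witnesses(1), where h = "e0 + pauli x"]
        witnesses_commutator(1)[of x 1] by simp_all
  qed (use curve \<open>\<tau> > 0\<close> x normal_covector_min normal_covector_values in \<open>auto simp: W_iff\<close>)
  moreover have "abnormal_isotropic_extremal g"
    unfolding abnormal_isotropic_extremal_def
  proof (intro conjI exI)
    show "control_of g (\<lambda>t. X)"
      using deriv1 X(1) by (simp add: control_of_def left_shift_def)
    show "adjoint_equation (\<lambda>t. X) (\<lambda>t. abnormal_covector x)"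
      "abs_continuous_covector (\<lambda>t. abnormal_covector x)"
      using stationary_covector[OF covector_witnesses(2), where h = X] witnesses_commutator(2)[of x \<tau>]
      by (simp_all add: X_eq P_def)
    have "abnormal_covector x (mat \<i> ** pauli x) \<noteq> 0"
      using x by (simp add: abnormal_covector_values)
    then show "\<forall>t. \<exists>v\<in>glp. abnormal_covector x v \<noteq> 0"
      using pauli_in_glp(2) by blast
  qed (use curve abnormal_covector_values in auto)
  ultimately show ?thesis
    by (simp add: nonstrictly_abnormal_def)
qed

theorem proposition14:
  fixes g :: "real \<Rightarrow> complex^2^2"
  assumes "isotropic_extremal g"
  shows "nonstrictly_abnormal g \<longleftrightarrow>
    (\<exists>X\<in>Herm. X \<noteq> 0 \<and> pseudo_prod X X = 0 \<and>
       (g = one_param_subgroup X \<or>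
        (\<exists>a\<in>GLp. g = (\<lambda>t. left_shift a (one_param_subgroup X t)))))"
proof
  assume "nonstrictly_abnormal g"
  then obtain X where "X \<in> Herm" "X \<noteq> 0" "pseudo_prod X X = 0" "g 0 \<in> GLp"
    "g = (\<lambda>t. left_shift (g 0) (one_param_subgroup X t))"
    unfolding nonstrictly_abnormal_def by (metis nonstrictly_abnormal_imp_shifted_subgroup)
  then show "\<exists>X\<in>Herm. X \<noteq> 0 \<and> pseudo_prod X X = 0 \<and>
       (g = one_param_subgroup X \<or>
        (\<exists>a\<in>GLp. g = (\<lambda>t. left_shift a (one_param_subgroup X t))))"
    by blast
next
  assume "\<exists>X\<in>Herm. X \<noteq> 0 \<and> pseudo_prod X X = 0 \<and>
       (g = one_param_subgroup X \<or>
        (\<exists>a\<in>GLp. g = (\<lambda>t. left_shift a (one_param_subgroup X t))))"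
  then obtain X a where X: "X \<in> Herm" "X \<noteq> 0" "pseudo_prod X X = 0"
    and g: "g = (\<lambda>t. a ** one_param_subgroup X t)"
  proof (elim bexE conjE disjE)
    fix X assume "X \<in> Herm" "X \<noteq> 0" "pseudo_prod X X = 0" "g = one_param_subgroup X"
    then show thesis
      using that[of X "mat 1"] by simp
  next
    fix X a assume "X \<in> Herm" "X \<noteq> 0" "pseudo_prod X X = 0"
      "g = (\<lambda>t. left_shift a (one_param_subgroup X t))"
    then show thesis
      using that[of X a] by (simp add: left_shift_def)
  qed
  moreover have "isotropic_curve g"
    using assms by (auto simp: isotropic_extremal_def normal_isotropic_extremal_def
        abnormal_isotropic_extremal_def)
  ultimately show "nonstrictly_abnormal g"
    by (intro isotropic_subgroup_nonstrictly_abnormal)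
qed

end
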